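(* Let $\Sigma$ be an alphabet with at least three letters, and let $\langle \mathcal{T},\star\rangle$ be the algebra of complete binary trees with leaves labeled by letters of $\Sigma$. Then every congruence preserving function $f\colon \mathcal{T}\to\mathcal{T}$ is polynomial, i.e., there exists a polynomial $T(x)$ such that $f(t)=T(t)$ for all $t\in\mathcal{T}$.
   Context: $\langle\mathcal{T},\star\rangle$ is the free algebra with one binary operation generated by the set $\Sigma$. It is represented as follows: let $\Xi=\{\blacktriangleleft,\bullet,\blacktriangleright\}$ be disjoint from $\Sigma$; $\mathcal{T}$ is the least set of nonempty words over $\Sigma\cup\Xi$ (called trees) containing every letter $a\in\Sigma$ and containing the word $\blacktriangleleft t\bullet t'\blacktriangleright$ whenever it contains $t$ and $t'$; the operation is $t\star t'=\blacktriangleleft t\bullet t'\blacktriangleright$. A congruence on $\mathcal{T}$ is an equivalence relation $\sim$ on $\mathcal{T}$ such that $t_1\sim t_1'$ and $t_2\sim t_2'$ imply $t_1\star t_2\sim t_1'\star t_2'$. A function $f\colon\mathcal{T}\to\mathcal{T}$ is congruence preserving if for every congruence $\sim$ on $\mathcal{T}$ and all $t,t'\in\mathcal{T}$, $t\sim t'$ implies $f(t)\sim f(t')$. Let $x\notin\Sigma$ be a variable. A polynomial $T(x)$ is a tree over the alphabet $\Sigma\cup\{x\}$ (i.e. an element of the free binary algebra generated by $\Sigma\cup\{x\}$). The associated polynomial function $T\colon\mathcal{T}\to\mathcal{T}$ sends $t$ to the tree $T(t)$ obtained by replacing every leaf $x$ of $T(x)$ by $t$, i.e. the image of $T(x)$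 under the homomorphism that maps $x$ to $t$ and fixes each letter of $\Sigma$. A function on $\mathcal{T}$ is polynomial if it is of this form. *)

theory Defs
  imports Main
begin

text \<open>The free algebra with one binary operation generated by the letters of the type \<open>'a\<close>,
  i.e. the complete binary trees with leaves labeled by letters. The alphabet \<open>\<Sigma>\<close> is the
  universe of \<open>'a\<close>, not necessarily finite.\<close>

datatype 'a tree = Leaf 'a | Star "'a tree" "'a tree"  (infix "\<star>" 70)

definition congruence :: "('a tree \<Rightarrow> 'a tree \<Rightarrow> bool) \<Rightarrow> bool" where
  "congruence R \<longleftrightarrow>
     equivp R \<and>
     (\<forall>t1 t1' t2 t2'. R t1 t1' \<longrightarrow> R t2 t2' \<longrightarrow> R (t1 \<star> t2) (t1' \<star> t2'))"

definition congruence_preserving :: "('a tree \<Rightarrow> 'a tree) \<Rightarrow> bool" where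
  "congruence_preserving f \<longleftrightarrow>
     (\<forall>R. congruence R \<longrightarrow> (\<forall>t t'. R t t' \<longrightarrow> R (f t) (f t')))"

text \<open>The homomorphism from the free algebra generated by \<open>'b\<close> that extends \<open>h\<close>.\<close>

primrec tree_hom :: "('b \<Rightarrow> 'a tree) \<Rightarrow> 'b tree \<Rightarrow> 'a tree" where
  "tree_hom h (Leaf b) = h b"
| "tree_hom h (t \<star> t') = tree_hom h t \<star> tree_hom h t'"

text \<open>In the alphabet \<open>\<Sigma> \<union> {x}\<close> of polynomials, \<open>None\<close> is the variable \<open>x\<close> and \<open>Some a\<close> is the
  letter \<open>a \<in> \<Sigma>\<close>.\<close>

type_synonym 'a polynomial = "'a option tree"

definition polynomial_function :: "'a polynomial \<Rightarrow> 'a tree \<Rightarrow> 'a tree" where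
  "polynomial_function T t = tree_hom (case_option t Leaf) T"

end

theory Submission
  imports Defs
begin

text \<open>
  A congruence that identifies a tree \<open>t\<close> with a letter \<open>a\<close> ties \<open>f t\<close> to \<open>f (Leaf a)\<close>. The proof
  uses only the least such congruences. Each of them is the kernel of the normal form map
  \<open>collapse t a\<close> of the rewrite rule \<open>t \<rightarrow> Leaf a\<close>; a single ground rule that shrinks
  trees is terminating and has no critical pairs.

  On letters: identifying the letters \<open>d\<close> and \<open>e\<close> shows that \<open>f (Leaf d)\<close> and \<open>f (Leaf e)\<close> have the
  same shape and that, at each leaf, their labels agree or are \<open>d\<close> and \<open>e\<close> in some order. So each leaf
  position defines a self-map of the alphabet that preserves every equivalence identifying only two
  letters. As soon as there are three letters, such a map is constant or the identity
  (\<open>letter_map_const_or_id\<close>). Writing the constant at the leaves of the first kind, and the variable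
  at those of the second, gives a polynomial \<open>T\<close> that agrees with \<open>f\<close> on all letters
  (\<open>polynomial_from_letters\<close>).

  On a composite tree \<open>t\<close>: for every letter \<open>a\<close>, modulo \<open>t \<sim> Leaf a\<close> one has
  \<open>f t \<sim> f (Leaf a) = T(Leaf a) \<sim> T(t)\<close>. For two distinct letters \<open>a\<close> and \<open>b\<close> the corresponding
  congruences intersect in the equality (\<open>collapse_two_letters_inj\<close>), whence \<open>f t = T(t)\<close>.
\<close>

primrec collapse :: "'a tree \<Rightarrow> 'a \<Rightarrow> 'a tree \<Rightarrow> 'a tree" where
  "collapse t a (Leaf x) = (if Leaf x = t then Leaf a else Leaf x)"
| "collapse t a (u \<star> v) =
     (if collapse t a u \<star> collapse t a v = t then Leaf a else collapse t a u \<star> collapse t a v)"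

lemma congruence_collapse: "congruence (\<lambda>u v. collapse t a u = collapse t a v)"
  unfolding congruence_def by (auto intro!: equivpI reflpI sympI transpI)

lemma collapse_smaller: "size s < size t \<Longrightarrow> collapse t a s = s"
  by (induction s) auto

lemma collapse_self: "collapse t a t = Leaf a"
proof (cases t)
  case (Star u v)
  then have "collapse t a u = u" "collapse t a v = v"
    by (auto intro!: collapse_smaller)
  with Star show ?thesis by simp
qed simp

text \<open>The target letter is irreducible; this includes the degenerate rule \<open>Leaf a \<rightarrow> Leaf a\<close>.\<close>

lemma collapse_target: "collapse t a (Leaf a) = Leaf a"
  by simp

lemma congruence_preserving_collapse:
  assumes "congruence_preserving f"
  shows "collapse t a (f t) = collapse t a (f (Leaf a))"
proof -
  have "collapse t a t = collapse t a (Leaf a)"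
    by (simp only: collapse_self collapse_target)
  with congruence_collapse[of t a] assms show ?thesis
    unfolding congruence_preserving_def by blast
qed

lemma congruence_preserving_polynomial_function:
  "congruence_preserving (polynomial_function T)"
  unfolding congruence_preserving_def
proof (intro allI impI)
  fix R :: "'a tree \<Rightarrow> 'a tree \<Rightarrow> bool" and t t'
  assume R: "congruence R" and tt': "R t t'"
  have "R u u" for u
    using R unfolding congruence_def by (auto intro: equivp_reflp)
  with R tt' show "R (polynomial_function T t) (polynomial_function T t')"
    unfolding polynomial_function_def congruence_def
    by (induction T) (auto split: option.split)
qed

text \<open>For a composite \<open>t\<close>, a product never has the same normal form as a letter unless that letter is
  the target, and two products with equal normal forms either both reduce at the root or both do
  not; in either case their factors have equal normal forms. So a difference between \<open>u\<close> and \<open>v\<close>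
  descends to a leaf of one of them, and there two distinct targets exclude each other.\<close>

lemma collapse_two_letters_inj:
  assumes "a \<noteq> b"
    and "collapse (l \<star> r) a u = collapse (l \<star> r) a v"
    and "collapse (l \<star> r) b u = collapse (l \<star> r) b v"
  shows "u = v"
  using assms(2,3)
proof (induction u arbitrary: v)
  case (Leaf x)
  with assms(1) show ?case by (cases v) (auto split: if_splits)
next
  case (Star u1 u2)
  show ?case
  proof (cases v)
    case (Leaf x)
    with Star.prems assms(1) show ?thesis by (auto split: if_splits)
  next
    case v: (Star v1 v2)
    from Star.prems(1) v have
      "collapse (l \<star> r) a u1 = collapse (l \<star> r) a v1"
      "collapse (l \<star> r) a u2 = collapse (l \<star> r) a v2"
      by (auto split: if_splits)
    moreover from Star.prems(2) v have
      "collapse (l \<star> r) b u1 = collapse (l \<star> r) b v1"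
      "collapse (l \<star> r) b u2 = collapse (l \<star> r) b v2"
      by (auto split: if_splits)
    ultimately show ?thesis using Star.IH v by simp
  qed
qed

text \<open>With only two letters the exchange of both would be a further solution; a third letter \<open>r\<close>
  rules it out, since \<open>h r\<close> would have to agree with both exchanged values.\<close>

lemma letter_map_const_or_id:
  fixes h :: "'a \<Rightarrow> 'a"
  assumes three: "\<exists>a b c :: 'a. a \<noteq> b \<and> a \<noteq> c \<and> b \<noteq> c"
    and h: "\<And>d e. h d = h e \<or> (h d = d \<and> h e = e) \<or> (h d = e \<and> h e = d)"
  shows "(\<exists>c. \<forall>d. h d = c) \<or> (\<forall>d. h d = d)"
proof (rule disjCI)
  assume not_id: "\<not> (\<forall>d. h d = d)"
  show "\<exists>c. \<forall>d. h d = c"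
  proof (rule ccontr)
    assume "\<not> (\<exists>c. \<forall>d. h d = c)"
    then obtain p q where pq: "h p \<noteq> h q" by metis
    obtain r where r: "r \<noteq> p" "r \<noteq> q" using three by metis
    have "h p = p" "h q = q" using pq r h[of p q] h[of p r] h[of q r] by metis+
    then have "h d = d" for d using pq h[of p d] h[of q d] by metis
    with not_id show False by simp
  qed
qed

text \<open>The induction follows the common shape of the values of \<open>g\<close>, read off at one letter \<open>c\<close>.\<close>

lemma polynomial_from_letters:
  fixes g :: "'a \<Rightarrow> 'a tree"
  assumes three: "\<exists>a b c :: 'a. a \<noteq> b \<and> a \<noteq> c \<and> b \<noteq> c"
    and "\<And>d e. collapse (Leaf d) e (g d) = collapse (Leaf d) e (g e)"
  shows "\<exists>T. \<forall>d. g d = polynomial_function T (Leaf d)"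
proof -
  fix c :: 'a
  obtain s where "g c = s" by simp
  then show ?thesis using assms(2)
  proof (induction s arbitrary: g)
    case (Leaf x)
    have "\<exists>y. g d = Leaf y" for d
      using Leaf.prems(1) Leaf.prems(2)[of c d] by (cases "g d") (auto split: if_splits)
    then obtain h where h: "\<And>d. g d = Leaf (h d)" by metis
    have "h d = h e \<or> (h d = d \<and> h e = e) \<or> (h d = e \<and> h e = d)" for d e
      using Leaf.prems(2)[of d e] by (auto simp: h split: if_splits)
    from letter_map_const_or_id[OF three this] show ?case
    proof
      assume "\<exists>k. \<forall>d. h d = k"
      then obtain k where "\<And>d. h d = k" by blast
      then have "\<forall>d. g d = polynomial_function (Leaf (Some k)) (Leaf d)"
        by (simp add: h polynomial_function_def)
      then show ?thesis by blast
    next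
      assume "\<forall>d. h d = d"
      then have "\<forall>d. g d = polynomial_function (Leaf None) (Leaf d)"
        by (simp add: h polynomial_function_def)
      then show ?thesis by blast
    qed
  next
    case (Star s1 s2)
    have "\<exists>y z. g d = y \<star> z" for d
      using Star.prems(1) Star.prems(2)[of c d] by (cases "g d") (auto split: if_splits)
    then obtain g1 g2 where g: "\<And>d. g d = g1 d \<star> g2 d" by metis
    have "g1 c = s1" "g2 c = s2" using Star.prems(1) g by auto
    moreover have
      "collapse (Leaf d) e (g1 d) = collapse (Leaf d) e (g1 e)"
      "collapse (Leaf d) e (g2 d) = collapse (Leaf d) e (g2 e)" for d e
      using Star.prems(2)[of d e] by (auto simp: g)
    ultimately have
      "\<exists>T. \<forall>d. g1 d = polynomial_function T (Leaf d)"
      "\<exists>T. \<forall>d. g2 d = polynomial_function T (Leaf d)"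
      using Star.IH(1)[of g1] Star.IH(2)[of g2] by blast+
    then obtain T1 T2 where
      "\<And>d. g1 d = polynomial_function T1 (Leaf d)"
      "\<And>d. g2 d = polynomial_function T2 (Leaf d)"
      by blast
    then have "\<forall>d. g d = polynomial_function (T1 \<star> T2) (Leaf d)"
      by (simp add: g polynomial_function_def)
    then show ?case by blast
  qed
qed

theorem theorem5p2:
  fixes f :: "'a tree \<Rightarrow> 'a tree"
  assumes "\<exists>a b c :: 'a. a \<noteq> b \<and> a \<noteq> c \<and> b \<noteq> c"
    and "congruence_preserving f"
  shows "\<exists>T :: 'a polynomial. \<forall>t. f t = polynomial_function T t"
proof -
  obtain T where letters: "\<And>d. f (Leaf d) = polynomial_function T (Leaf d)"
    using polynomial_from_letters[of "\<lambda>d. f (Leaf d)", OF assms(1)]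
      congruence_preserving_collapse[OF assms(2)] by blast
  have "f t = polynomial_function T t" for t
  proof (cases t)
    case (Leaf d)
    then show ?thesis by (simp add: letters)
  next
    case (Star l r)
    obtain a b :: 'a where "a \<noteq> b" using assms(1) by blast
    have "collapse t d (f t) = collapse t d (polynomial_function T t)" for d
      using congruence_preserving_collapse[OF assms(2), of t d]
        congruence_preserving_collapse[OF congruence_preserving_polynomial_function, of t d T]
      by (simp add: letters)
    from \<open>a \<noteq> b\<close> this[of a, unfolded Star] this[of b, unfolded Star]
    show ?thesis unfolding Star by (rule collapse_two_letters_inj)
  qed
  then show ?thesis by blast
qed

end
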